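(* Let $(\tilde\lambda,\tilde v)$ be a Ritz pair of the oblique Rayleigh-Ritz procedure described in the context, approximating an exact eigenpair $(\lambda,v)$ of $H$, and let $\sigma_v$ be the error coefficient of $\tilde v$ with respect to $v$ defined there. Then the Ritz values converge quadratically, in the sense that $$|\lambda-\tilde\lambda|\le\kappa\cdot\mathcal{O}\big(\sigma_v^2\big)\qquad\text{with}\qquad \kappa:=\frac{\sqrt{\mathrm{cond}(H)}\cdot\|H-\lambda I\|_2}{|\lambda_{\min}(Q^*SQ)|}.$$
   Context: Let $m\ge1$, $n=2m$, and let $A,B\in\mathbb{C}^{m\times m}$ with $A=A^*$ and $B=B^T$. A bar denotes entrywise complex conjugation and $^*$ the conjugate transpose. Define $$H=\begin{bmatrix}A&B\\-\bar B&-\bar A\end{bmatrix},\qquad S=\begin{bmatrix}I_m&0\\0&-I_m\end{bmatrix},$$ and assume that $SH=\begin{bmatrix}A&B\\\bar B&\bar A\end{bmatrix}$ is hermitian positive definite. Let $Q\in\mathbb{C}^{n\times k}$ have orthonormal columns (a basis of the search space) with $Q^*SQ$ invertible. The oblique Rayleigh-Ritz procedure uses the dual basis $Q_{\mathcal L}=SQ(Q^*SQ)^{-1}$, which satisfies $Q_{\mathcal L}^*Q=I_k$, and the Rayleigh quotient $G=Q_{\mathcal L}^*HQ=(Q^*SQ)^{-1}Q^*SHQ$. A Ritz value $\tilde\lambda$ is an eigenvalue of $G$, $Gz=\tilde\lambda z$, and the associated approximate right eigenvector is $\tilde v=Qz$, normalized so that $\|\tilde v\|_2=1$. The exact eigenpair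 satisfies $Hv=\lambda v$ with $\|v\|_2=1$. The approximate eigenvector is decomposed as $\tilde v=\gamma_v v+\sigma_v e_v$ with scalars $\gamma_v,\sigma_v$ and a unit vector $e_v\perp v$; the coefficient $\sigma_v$ measures the error of $\tilde v$. Here $\mathrm{cond}(\cdot)$ is the $2$-norm condition number $\sigma_{\max}/\sigma_{\min}$ (ratio of largest to smallest singular value), and $\lambda_{\min}(\cdot)$ is the eigenvalue of smallest magnitude. *)

theory Defs
  imports
    "Jordan_Normal_Form.Schur_Decomposition"
    "Jordan_Normal_Form.Gauss_Jordan_Elimination"
    "Jordan_Normal_Form.Spectral_Radius"
begin

definition vec_norm2 :: "complex vec \<Rightarrow> real" where
  "vec_norm2 x = sqrt (\<Sum>i<dim_vec x. (cmod (x $ i))\<^sup>2)"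

definition op_norm2 :: "complex mat \<Rightarrow> real" where
  "op_norm2 M = (SUP x \<in> {x \<in> carrier_vec (dim_col M). vec_norm2 x = 1}. vec_norm2 (M *\<^sub>v x))"

definition singular_values :: "complex mat \<Rightarrow> real set" where
  "singular_values M = {s. 0 \<le> s \<and> eigenvalue (mat_adjoint M * M) (complex_of_real (s\<^sup>2))}"

definition cond2 :: "complex mat \<Rightarrow> real" where
  "cond2 M = Max (singular_values M) / Min (singular_values M)"

(* An eigenvalue of smallest magnitude. It need not be unique (for instance 1 and -1 for
   diag(1, -1)), but its modulus is, and only the modulus is used below. *)
definition eig_min :: "complex mat \<Rightarrow> complex" where
  "eig_min M = arg_min cmod (eigenvalue M)"

definition hermitian_mat :: "complex mat \<Rightarrow> bool" where
  "hermitian_mat M \<longleftrightarrow> square_mat M \<and> mat_adjoint M = M"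

(* (M *\<^sub>v x) \<bullet>c x is the quadratic form x* M x, which is real for hermitian M. *)
definition hermitian_pos_def :: "complex mat \<Rightarrow> bool" where
  "hermitian_pos_def M \<longleftrightarrow> hermitian_mat M \<and>
    (\<forall>x \<in> carrier_vec (dim_row M). x \<noteq> 0\<^sub>v (dim_row M) \<longrightarrow> 0 < Re ((M *\<^sub>v x) \<bullet>c x))"

definition H_mat :: "complex mat \<Rightarrow> complex mat \<Rightarrow> complex mat" where
  "H_mat A B = four_block_mat A B (- map_mat cnj B) (- map_mat cnj A)"

definition S_mat :: "nat \<Rightarrow> complex mat" where
  "S_mat m = four_block_mat (1\<^sub>m m) (0\<^sub>m m m) (0\<^sub>m m m) (- 1\<^sub>m m)"

definition dual_basis :: "complex mat \<Rightarrow> complex mat \<Rightarrow> complex mat" where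
  "dual_basis S Q = S * Q * the (mat_inverse (mat_adjoint Q * S * Q))"

definition rayleigh_quotient :: "complex mat \<Rightarrow> complex mat \<Rightarrow> complex mat \<Rightarrow> complex mat" where
  "rayleigh_quotient H S Q = mat_adjoint (dual_basis S Q) * H * Q"

definition ritz_pair ::
    "complex mat \<Rightarrow> complex mat \<Rightarrow> complex mat \<Rightarrow> complex \<Rightarrow> complex vec \<Rightarrow> bool" where
  "ritz_pair H S Q mu w \<longleftrightarrow>
    (\<exists>z. eigenvector (rayleigh_quotient H S Q) z mu \<and> w = Q *\<^sub>v z \<and> vec_norm2 w = 1)"

definition kappa :: "complex mat \<Rightarrow> complex mat \<Rightarrow> complex mat \<Rightarrow> complex \<Rightarrow> real" where
  "kappa H S Q lam =
    sqrt (cond2 H) * op_norm2 (H - lam \<cdot>\<^sub>m 1\<^sub>m (dim_row H))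
      / cmod (eig_min (mat_adjoint Q * S * Q))"

end

theory Submission
  imports Defs
begin

text \<open>
  The constant $C = 1$ works, for every dimension. Put $M = SH$, $T = Q^*SQ$ and let $w = Qz$ be the
  unit Ritz vector. Since $S^2 = I$, both eigenvalue problems are hermitian-definite pencils:
  $Mv = \lambda Sv$ for the exact pair and $Q^*Mw = \tilde\lambda Tz$ for the Ritz pair.
  The first pencil forces $\lambda$ to be real, so $K = M - \lambda S = S(H - \lambda I)$ is
  hermitian and annihilates $v$. Inserting $w = \gamma v + \sigma e$, only the quadratic term
  survives:
  \[ (\tilde\lambda - \lambda)\, w^*Sw = w^*Kw = |\sigma|^2\, e^*Ke,
     \qquad |e^*Ke| \le \|H - \lambda I\|_2 . \]

  What remains is that the indefinite form $w^*Sw$ cannot be too small, namely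
  $|\lambda_{\min}(T)| \le \sqrt{\mathrm{cond}(H)}\,|w^*Sw|$. The Ritz equation gives
  $\tilde\lambda\, w^*Sw = w^*Mw$ and $|\tilde\lambda|\,\|Tz\| = \|Q^*Mw\| \le \|Mw\|$, so after
  multiplication by $|\tilde\lambda|$ this follows from $|\lambda_{\min}(T)| \le \|Tz\|$ and
  $\|Mw\| \le \sqrt{\mathrm{cond}(H)}\; w^*Mw$. The latter
  (\<open>pos_def_norm_le_sqrt_cond2\<close>) combines $\|Mw\|^2 \le s_{\max}\, w^*Mw$ and
  $s_{\min} \le w^*Mw$, where $s_{\max}, s_{\min}$ are the extreme singular values of $H$; these are
  the extreme eigenvalues of $M$, because $H^*H = M^2$.

  All estimates by extreme eigenvalues rest on the single fact that a hermitian matrix $X$ satisfies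
  $\|Xx\| \le \rho(X)\,\|x\|$ (\<open>hermitian_norm_le_spectral\<close>). It is derived without
  diagonalizing $X$: for a unit vector, $\|Xx\|^{2^j} \le \|X^{2^j}x\|$, and powers of a matrix of
  spectral radius below $1$ stay bounded. Lower bounds come from applying it to the inverse matrix.
\<close>

section \<open>Conjugate transposes and scalar multiples\<close>

lemma mat_adjoint_carrier [simp]:
  "A \<in> carrier_mat nr nc \<Longrightarrow> mat_adjoint A \<in> carrier_mat nc nr"
  by (auto simp: mat_adjoint_def)

lemma index_mat_adjoint [simp]:
  fixes A :: "complex mat"
  assumes "i < dim_col A" "j < dim_row A"
  shows "mat_adjoint A $$ (i, j) = cnj (A $$ (j, i))"
  using assms by (simp add: mat_adjoint_def mat_of_rows_index)

lemma dim_mat_adjoint [simp]: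
  "dim_row (mat_adjoint A) = dim_col A" "dim_col (mat_adjoint A) = dim_row A"
  by (auto simp: mat_adjoint_def)

lemma mat_adjoint_adjoint [simp]:
  fixes A :: "complex mat"
  shows "mat_adjoint (mat_adjoint A) = A"
  by (rule eq_matI) auto

lemma mat_adjoint_mult:
  fixes A B :: "complex mat"
  assumes "A \<in> carrier_mat nr n" "B \<in> carrier_mat n nc"
  shows "mat_adjoint (A * B) = mat_adjoint B * mat_adjoint A"
  using assms by (intro eq_matI) (auto simp: scalar_prod_def mult.commute)

lemma mat_adjoint_one [simp]: "mat_adjoint (1\<^sub>m n :: complex mat) = 1\<^sub>m n"
  by (rule eq_matI) auto

lemma mat_adjoint_smult:
  fixes A :: "complex mat"
  shows "mat_adjoint (c \<cdot>\<^sub>m A) = cnj c \<cdot>\<^sub>m mat_adjoint A"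
  by (rule eq_matI) auto

lemma mat_adjoint_minus:
  fixes A B :: "complex mat"
  assumes "A \<in> carrier_mat nr nc" "B \<in> carrier_mat nr nc"
  shows "mat_adjoint (A - B) = mat_adjoint A - mat_adjoint B"
  using assms by (intro eq_matI) auto

lemma smult_zero_vec_left: "(0::complex) \<cdot>\<^sub>v x = 0\<^sub>v (dim_vec x)"
  by (rule eq_vecI) auto

lemma smult_zero_vec_right: "(c::complex) \<cdot>\<^sub>v 0\<^sub>v n = 0\<^sub>v n"
  by (rule eq_vecI) auto

lemma smult_mat_mult_vec:
  fixes A :: "complex mat"
  assumes "A \<in> carrier_mat nr nc" "x \<in> carrier_vec nc"
  shows "(c \<cdot>\<^sub>m A) *\<^sub>v x = c \<cdot>\<^sub>v (A *\<^sub>v x)"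
  using assms by (intro eq_vecI) auto

section \<open>Inner product and Euclidean norm\<close>

lemma cscalar_prod_sum:
  fixes x y :: "complex vec"
  assumes "dim_vec x = n" "dim_vec y = n"
  shows "x \<bullet>c y = (\<Sum>i<n. x $ i * cnj (y $ i))"
  using assms by (simp add: scalar_prod_def atLeast0LessThan)

lemma cscalar_prod_adjoint:
  fixes A :: "complex mat"
  assumes A: "A \<in> carrier_mat nr nc" and x: "x \<in> carrier_vec nc" and y: "y \<in> carrier_vec nr"
  shows "(A *\<^sub>v x) \<bullet>c y = x \<bullet>c (mat_adjoint A *\<^sub>v y)"
proof -
  have "(A *\<^sub>v x) \<bullet>c y = (\<Sum>i<nr. (\<Sum>j<nc. A $$ (i,j) * x $ j) * cnj (y $ i))"
    using assms by (subst cscalar_prod_sum[of _ nr])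
      (auto simp: scalar_prod_def atLeast0LessThan intro!: sum.cong)
  also have "\<dots> = (\<Sum>j<nc. \<Sum>i<nr. A $$ (i,j) * x $ j * cnj (y $ i))"
    by (subst sum.swap) (simp add: sum_distrib_right)
  also have "\<dots> = (\<Sum>j<nc. x $ j * cnj (\<Sum>i<nr. cnj (A $$ (i,j)) * y $ i))"
    by (simp add: sum_distrib_left mult_ac)
  also have "\<dots> = x \<bullet>c (mat_adjoint A *\<^sub>v y)"
    using assms by (subst cscalar_prod_sum[of _ nc])
      (auto simp: scalar_prod_def atLeast0LessThan intro!: sum.cong)
  finally show ?thesis .
qed

lemma cscalar_prod_cnj:
  fixes x y :: "complex vec"
  assumes "dim_vec x = dim_vec y"
  shows "cnj (x \<bullet>c y) = y \<bullet>c x"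
  using assms by (subst (1 2) cscalar_prod_sum) (auto simp: mult.commute)

lemma cscalar_prod_self:
  fixes x :: "complex vec"
  shows "x \<bullet>c x = complex_of_real ((vec_norm2 x)\<^sup>2)"
proof -
  have "x \<bullet>c x = (\<Sum>i<dim_vec x. complex_of_real ((cmod (x $ i))\<^sup>2))"
    by (subst cscalar_prod_sum) (auto simp: complex_mult_cnj cmod_power2 intro!: sum.cong)
  then show ?thesis
    by (simp add: vec_norm2_def sum_nonneg)
qed

lemma vec_norm2_nonneg [simp]: "0 \<le> vec_norm2 x"
  by (simp add: vec_norm2_def sum_nonneg)

lemma vec_norm2_eq_0:
  assumes "x \<in> carrier_vec n"
  shows "vec_norm2 x = 0 \<longleftrightarrow> x = 0\<^sub>v n"
proof -
  have "vec_norm2 x = 0 \<longleftrightarrow> x \<bullet>c x = 0"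
    by (simp add: cscalar_prod_self)
  with assms show ?thesis by simp
qed

lemma vec_norm2_zero [simp]: "vec_norm2 (0\<^sub>v n) = 0"
  by (simp add: vec_norm2_def)

lemma vec_norm2_smult: "vec_norm2 (c \<cdot>\<^sub>v x) = cmod c * vec_norm2 x"
  by (simp add: vec_norm2_def norm_mult power_mult_distrib real_sqrt_mult flip: sum_distrib_left)

lemma cmod_index_le_vec_norm2:
  assumes "i < dim_vec x"
  shows "cmod (x $ i) \<le> vec_norm2 x"
proof -
  have "(cmod (x $ i))\<^sup>2 \<le> (\<Sum>i<dim_vec x. (cmod (x $ i))\<^sup>2)"
    using assms by (intro member_le_sum) auto
  then show ?thesis
    unfolding vec_norm2_def by (simp add: real_le_rsqrt)
qed

lemma cscalar_prod_hermitian_real: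
  fixes M :: "complex mat"
  assumes M: "M \<in> carrier_mat n n" "mat_adjoint M = M" and x: "x \<in> carrier_vec n"
  shows "(M *\<^sub>v x) \<bullet>c x = complex_of_real (Re ((M *\<^sub>v x) \<bullet>c x))"
proof -
  have "cnj ((M *\<^sub>v x) \<bullet>c x) = (M *\<^sub>v x) \<bullet>c x"
    using cscalar_prod_adjoint[OF M(1) x x] M x by (simp add: cscalar_prod_cnj)
  then show ?thesis
    by (metis Reals_cnj_iff of_real_Re)
qed

section \<open>The Cauchy-Schwarz inequality of a positive definite form\<close>

lemma hermitian_pos_def_carrier:
  assumes "hermitian_pos_def M" "M \<in> carrier_mat n n"
  shows "mat_adjoint M = M"
    "x \<in> carrier_vec n \<Longrightarrow> x \<noteq> 0\<^sub>v n \<Longrightarrow> 0 < Re ((M *\<^sub>v x) \<bullet>c x)"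
    "x \<in> carrier_vec n \<Longrightarrow> 0 \<le> Re ((M *\<^sub>v x) \<bullet>c x)"
proof -
  show "mat_adjoint M = M"
    using assms by (auto simp: hermitian_pos_def_def hermitian_mat_def)
  show pos: "x \<in> carrier_vec n \<Longrightarrow> x \<noteq> 0\<^sub>v n \<Longrightarrow> 0 < Re ((M *\<^sub>v x) \<bullet>c x)"
    using assms by (auto simp: hermitian_pos_def_def)
  show "x \<in> carrier_vec n \<Longrightarrow> 0 \<le> Re ((M *\<^sub>v x) \<bullet>c x)"
    using pos assms by (cases "x = 0\<^sub>v n") auto
qed

lemma hermitian_pos_def_one: "hermitian_pos_def (1\<^sub>m n)"
  unfolding hermitian_pos_def_def hermitian_mat_def
  by (auto simp: cscalar_prod_self vec_norm2_eq_0)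

text \<open>
  The form is nonnegative at $z = x - (b/q)\,y$, where $b = y^*Mx$ and $q = y^*My$, and equals
  $x^*Mx - |b|^2/q$ there. The general $M$ is used twice: with $M = I$ for the Euclidean norm, and with
  $M = SH$ to bring in its extreme eigenvalues.
\<close>
lemma Cauchy_Schwarz_pos_def:
  fixes M :: "complex mat"
  assumes pd: "hermitian_pos_def M" and M: "M \<in> carrier_mat n n"
    and x: "x \<in> carrier_vec n" and y: "y \<in> carrier_vec n"
  shows "(cmod ((M *\<^sub>v x) \<bullet>c y))\<^sup>2 \<le> Re ((M *\<^sub>v x) \<bullet>c x) * Re ((M *\<^sub>v y) \<bullet>c y)"
proof (cases "y = 0\<^sub>v n")
  case True
  with M x show ?thesis by simp
next
  case False
  note herm = hermitian_pos_def_carrier[OF pd M]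
  define p where "p = Re ((M *\<^sub>v x) \<bullet>c x)"
  define q where "q = Re ((M *\<^sub>v y) \<bullet>c y)"
  define b where "b = (M *\<^sub>v x) \<bullet>c y"
  define t where "t = - (b / of_real q)"
  have q: "q > 0" using herm(2)[OF y False] by (simp add: q_def)
  have xx: "(M *\<^sub>v x) \<bullet>c x = of_real p" and yy: "(M *\<^sub>v y) \<bullet>c y = of_real q"
    unfolding p_def q_def using cscalar_prod_hermitian_real[OF M herm(1)] x y by auto
  have yx: "(M *\<^sub>v y) \<bullet>c x = cnj b"
    using cscalar_prod_adjoint[OF M y x] M x y herm(1) by (simp add: b_def cscalar_prod_cnj)
  define z where "z = x + t \<cdot>\<^sub>v y"
  have z: "z \<in> carrier_vec n" using x y by (simp add: z_def)
  have Mx: "M *\<^sub>v x \<in> carrier_vec n" and My: "M *\<^sub>v y \<in> carrier_vec n" using M x y by auto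
  have Mz: "M *\<^sub>v z = M *\<^sub>v x + t \<cdot>\<^sub>v (M *\<^sub>v y)"
    using M x y by (simp add: z_def mult_add_distrib_mat_vec mult_mat_vec)
  have cz: "conjugate z = conjugate x + cnj t \<cdot>\<^sub>v conjugate y"
    using x y by (simp add: z_def conjugate_add_vec[of _ n] conjugate_smult_vec)
  have "(M *\<^sub>v z) \<bullet>c z = of_real p + cnj t * b + t * cnj b + t * cnj t * of_real q"
    unfolding Mz cz using x y Mx My
    by (simp add: add_scalar_prod_distrib[of _ n] scalar_prod_add_distrib[of _ n] xx yy yx
        algebra_simps flip: b_def)
  also have "\<dots> = of_real (p - (cmod b)\<^sup>2 / q)"
  proof -
    have "complex_of_real ((cmod b)\<^sup>2) = b * cnj b"
      by (simp only: complex_norm_square)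
    then show ?thesis
      using q by (simp add: t_def field_simps del: of_real_power)
  qed
  finally have "0 \<le> p - (cmod b)\<^sup>2 / q"
    using herm(3)[OF z] by simp
  with q show ?thesis
    by (simp add: field_simps flip: p_def q_def b_def)
qed

lemma Cauchy_Schwarz_vec:
  assumes "x \<in> carrier_vec n" "y \<in> carrier_vec n"
  shows "cmod (x \<bullet>c y) \<le> vec_norm2 x * vec_norm2 y"
proof (rule power2_le_imp_le)
  show "(cmod (x \<bullet>c y))\<^sup>2 \<le> (vec_norm2 x * vec_norm2 y)\<^sup>2"
    using Cauchy_Schwarz_pos_def[OF hermitian_pos_def_one one_carrier_mat assms] assms
    by (simp add: cscalar_prod_self power_mult_distrib)
qed simp

section \<open>Entrywise bounds and the operator norm\<close>

lemma vec_norm2_mult_le_norm_bound: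
  fixes A :: "complex mat"
  assumes A: "A \<in> carrier_mat nr nc" and bd: "norm_bound A b" and b: "0 \<le> b"
    and x: "x \<in> carrier_vec nc" "vec_norm2 x = 1"
  shows "vec_norm2 (A *\<^sub>v x) \<le> sqrt (real nr) * (real nc * b)"
proof -
  have entry: "cmod ((A *\<^sub>v x) $ i) \<le> real nc * b" if i: "i < nr" for i
  proof -
    have "(A *\<^sub>v x) $ i = (\<Sum>j<nc. A $$ (i,j) * x $ j)"
      using A x i by (auto simp: scalar_prod_def atLeast0LessThan)
    also have "cmod \<dots> \<le> (\<Sum>j<nc. b * 1)"
    proof (rule sum_norm_le)
      fix j assume "j \<in> {..<nc}"
      then have "cmod (A $$ (i,j)) \<le> b" "cmod (x $ j) \<le> 1"
        using A x i bd cmod_index_le_vec_norm2[of j x] by (auto simp: norm_bound_def)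
      then show "cmod (A $$ (i,j) * x $ j) \<le> b * 1"
        unfolding norm_mult using b by (intro mult_mono) auto
    qed
    finally show ?thesis by simp
  qed
  have "(\<Sum>i<nr. (cmod ((A *\<^sub>v x) $ i))\<^sup>2) \<le> (\<Sum>i<nr. (real nc * b)\<^sup>2)"
    using entry by (intro sum_mono power_mono) auto
  then have "vec_norm2 (A *\<^sub>v x) \<le> sqrt (\<Sum>i<nr. (real nc * b)\<^sup>2)"
    using A by (simp only: vec_norm2_def real_sqrt_le_iff dim_mult_mat_vec carrier_matD(1)[OF A])
  also have "\<dots> = sqrt (real nr) * (real nc * b)"
    using b by (simp add: real_sqrt_mult)
  finally show ?thesis .
qed

text \<open>
  A supremum of reals dominates its elements only when the set is bounded above; the sum of the
  moduli of all entries supplies a bound.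
\<close>
lemma vec_norm2_mult_le_op_norm2:
  fixes A :: "complex mat"
  assumes x: "x \<in> carrier_vec (dim_col A)" "vec_norm2 x = 1"
  shows "vec_norm2 (A *\<^sub>v x) \<le> op_norm2 A"
proof -
  define b where "b = (\<Sum>i<dim_row A. \<Sum>j<dim_col A. cmod (A $$ (i,j)))"
  have b: "0 \<le> b" by (simp add: b_def sum_nonneg)
  have "norm_bound A b"
  proof
    fix i j assume ij: "i < dim_row A" "j < dim_col A"
    have "cmod (A $$ (i,j)) \<le> (\<Sum>j<dim_col A. cmod (A $$ (i,j)))"
      using ij by (intro member_le_sum) auto
    also have "\<dots> \<le> b"
      unfolding b_def using ij
      by (intro member_le_sum[of i _ "\<lambda>i. \<Sum>j<dim_col A. cmod (A $$ (i,j))"]) (auto simp: sum_nonneg)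
    finally show "norm (A $$ (i,j)) \<le> b" .
  qed
  then have "bdd_above ((\<lambda>x. vec_norm2 (A *\<^sub>v x)) ` {x \<in> carrier_vec (dim_col A). vec_norm2 x = 1})"
    using vec_norm2_mult_le_norm_bound[of A "dim_row A" "dim_col A" b] b
    by (intro bdd_aboveI2) auto
  then show ?thesis
    unfolding op_norm2_def using x by (intro cSUP_upper) auto
qed

section \<open>Norm bounds for hermitian matrices from their eigenvalues\<close>

lemma eigenvalue_hermitian_real:
  fixes X :: "complex mat"
  assumes X: "X \<in> carrier_mat n n" "mat_adjoint X = X" and ev: "eigenvector X x d"
  shows "d \<in> \<real>"
proof -
  have x: "x \<in> carrier_vec n" "x \<noteq> 0\<^sub>v n" and Xx: "X *\<^sub>v x = d \<cdot>\<^sub>v x"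
    using ev X by (auto simp: eigenvector_def)
  have "d * (x \<bullet>c x) = complex_of_real (Re (d * (x \<bullet>c x)))"
    using cscalar_prod_hermitian_real[OF X x(1)] x by (simp add: Xx)
  then have "d * (x \<bullet>c x) \<in> \<real>"
    by (metis Reals_of_real)
  moreover have "x \<bullet>c x \<in> \<real>" "x \<bullet>c x \<noteq> 0"
    using x by (auto simp: cscalar_prod_self vec_norm2_eq_0)
  ultimately show "d \<in> \<real>"
    by (metis Reals_divide nonzero_mult_div_cancel_right)
qed

lemma pow_mat_add:
  fixes X :: "complex mat"
  assumes X: "X \<in> carrier_mat n n"
  shows "X ^\<^sub>m (i + j) = X ^\<^sub>m i * X ^\<^sub>m j"
proof (induction j)
  case (Suc j)
  then show ?case
    using X assoc_mult_mat[of "X ^\<^sub>m i" n n "X ^\<^sub>m j" n X n] by simp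
qed (use X in simp)

lemma mat_adjoint_pow:
  fixes X :: "complex mat"
  assumes X: "X \<in> carrier_mat n n" "mat_adjoint X = X"
  shows "mat_adjoint (X ^\<^sub>m k) = X ^\<^sub>m k"
proof (induction k)
  case (Suc k)
  have "X * X ^\<^sub>m k = X ^\<^sub>m k * X"
    using pow_mat_add[OF X(1), of 1 k] pow_mat_add[OF X(1), of k 1] X by simp
  with Suc show ?case
    using X by (simp add: mat_adjoint_mult[of _ n n])
qed (use X in simp)

text \<open>
  For hermitian $Y$ and a unit vector $x$, $\|Yx\|^2 = x^*Y^2x \le \|Y^2x\|$. Doubling the exponent
  repeatedly turns a single application of $X$ into a high power of $X$.
\<close>
lemma hermitian_power_growth:
  fixes X :: "complex mat"
  assumes X: "X \<in> carrier_mat n n" "mat_adjoint X = X"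
    and x: "x \<in> carrier_vec n" "vec_norm2 x = 1"
  shows "vec_norm2 (X *\<^sub>v x) ^ (2 ^ k) \<le> vec_norm2 (X ^\<^sub>m (2 ^ k) *\<^sub>v x)"
proof (induction k)
  case 0
  then show ?case using X by simp
next
  case (Suc k)
  define Y where "Y = X ^\<^sub>m (2 ^ k)"
  have Y: "Y \<in> carrier_mat n n" "mat_adjoint Y = Y"
    using X mat_adjoint_pow[OF X] by (auto simp: Y_def)
  have Yx: "Y *\<^sub>v x \<in> carrier_vec n" using Y x by auto
  have YY: "X ^\<^sub>m (2 ^ Suc k) = Y * Y"
    using pow_mat_add[OF X(1), of "2 ^ k" "2 ^ k"] by (simp add: Y_def mult_2)
  have "vec_norm2 (X *\<^sub>v x) ^ (2 ^ Suc k) = (vec_norm2 (X *\<^sub>v x) ^ (2 ^ k))\<^sup>2"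
    by (simp add: power_mult mult.commute flip: power_mult)
  also have "\<dots> \<le> (vec_norm2 (Y *\<^sub>v x))\<^sup>2"
    using Suc by (intro power_mono) (auto simp: Y_def)
  also have "\<dots> = cmod ((Y *\<^sub>v x) \<bullet>c (Y *\<^sub>v x))"
    by (simp add: cscalar_prod_self norm_power)
  also have "(Y *\<^sub>v x) \<bullet>c (Y *\<^sub>v x) = (Y *\<^sub>v (Y *\<^sub>v x)) \<bullet>c x"
    using cscalar_prod_adjoint[OF Y(1) Yx x(1)] Y(2) by simp
  also have "Y *\<^sub>v (Y *\<^sub>v x) = (Y * Y) *\<^sub>v x"
    using Y x by simp
  also have "cmod (((Y * Y) *\<^sub>v x) \<bullet>c x) \<le> vec_norm2 ((Y * Y) *\<^sub>v x)"
    using Cauchy_Schwarz_vec[of "(Y * Y) *\<^sub>v x" n x] Y x by auto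
  finally show ?case by (simp only: YY)
qed

lemma eigenvalue_smult_matD:
  fixes A :: "complex mat"
  assumes "A \<in> carrier_mat n n" "c \<noteq> 0" "eigenvalue (c \<cdot>\<^sub>m A) d"
  shows "eigenvalue A (d / c)"
proof -
  obtain x where x: "x \<in> carrier_vec n" "x \<noteq> 0\<^sub>v n" and cx: "(c \<cdot>\<^sub>m A) *\<^sub>v x = d \<cdot>\<^sub>v x"
    using assms by (auto simp: eigenvalue_def eigenvector_def)
  have "c \<cdot>\<^sub>v (A *\<^sub>v x) = d \<cdot>\<^sub>v x"
    using cx smult_mat_mult_vec[OF assms(1) x(1)] by simp
  then have "(1 / c) \<cdot>\<^sub>v (c \<cdot>\<^sub>v (A *\<^sub>v x)) = (1 / c) \<cdot>\<^sub>v (d \<cdot>\<^sub>v x)"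
    by simp
  then have "A *\<^sub>v x = (d / c) \<cdot>\<^sub>v x"
    using assms(2) by (simp add: smult_smult_assoc)
  with x assms show ?thesis by (auto simp: eigenvalue_def eigenvector_def)
qed

text \<open>
  If $\|Xu\| > s > r$ for some unit vector $u$, then $Y = X/s$ has spectral radius below $1$, hence
  bounded powers, whereas $\|Y^{2^j}u\| \ge \|Yu\|^{2^j}$ grows without bound.
\<close>
lemma hermitian_norm_le_spectral:
  fixes X :: "complex mat"
  assumes X: "X \<in> carrier_mat n n" "mat_adjoint X = X"
    and ev: "\<And>d. eigenvalue X d \<Longrightarrow> cmod d \<le> r"
    and x: "x \<in> carrier_vec n"
  shows "vec_norm2 (X *\<^sub>v x) \<le> r * vec_norm2 x"
proof (cases "x = 0\<^sub>v n")
  case True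
  moreover have "X *\<^sub>v 0\<^sub>v n = 0\<^sub>v n" using X by auto
  ultimately show ?thesis by simp
next
  case False
  then have n: "n > 0" using x by (cases n) auto
  have nx: "vec_norm2 x > 0"
    using False x vec_norm2_eq_0[OF x] vec_norm2_nonneg[of x] by linarith
  define u where "u = complex_of_real (1 / vec_norm2 x) \<cdot>\<^sub>v x"
  have u: "u \<in> carrier_vec n" "vec_norm2 u = 1"
    using x nx by (auto simp: u_def vec_norm2_smult norm_divide)
  have r: "r \<ge> 0"
    using spectrum_non_empty[OF X(1) n] ev
    by (force simp: spectrum_def intro: order_trans[OF norm_ge_zero])
  have "vec_norm2 (X *\<^sub>v u) \<le> s" if s: "s > r" for s
  proof (rule ccontr)
    assume gt: "\<not> vec_norm2 (X *\<^sub>v u) \<le> s"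
    have s0: "s > 0" using r s by simp
    define Y where "Y = complex_of_real (1 / s) \<cdot>\<^sub>m X"
    have Y: "Y \<in> carrier_mat n n" "mat_adjoint Y = Y"
      using X by (auto simp: Y_def mat_adjoint_smult)
    have "cmod d < 1" if "eigenvalue Y d" for d
    proof -
      have "cmod (d / complex_of_real (1 / s)) \<le> r"
        using that s0 X by (intro ev eigenvalue_smult_matD[where c = "complex_of_real (1 / s)"])
          (auto simp: Y_def)
      then have "cmod d * s \<le> r" using s0 by (simp add: norm_mult)
      then have "cmod d * s < 1 * s" using s by simp
      then show ?thesis using s0 by (simp only: mult_less_cancel_right_pos)
    qed
    then have "spectral_radius Y < 1"
      using spectral_radius_mem_max(1)[OF Y(1) n] by (auto simp: spectrum_def)
    then obtain b where b: "\<And>k. norm_bound (Y ^\<^sub>m k) b"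
      using spectral_radius_jnf_norm_bound_less_1_upper_triangular[OF Y(1)] by blast
    have b0: "0 \<le> b"
      using b[of 0] n Y by (force simp: norm_bound_def intro: order_trans[OF norm_ge_zero])
    define a where "a = vec_norm2 (Y *\<^sub>v u)"
    have "Y *\<^sub>v u = complex_of_real (1 / s) \<cdot>\<^sub>v (X *\<^sub>v u)"
      using X u by (simp add: Y_def smult_mat_mult_vec[of _ n n])
    then have "a > 1"
      using gt s0 by (simp add: a_def vec_norm2_smult norm_divide)
    then obtain k where k: "sqrt (real n) * (real n * b) < a ^ k"
      using real_arch_pow by blast
    have "a ^ k \<le> a ^ (2 ^ k)"
      using \<open>a > 1\<close> by (intro power_increasing) (auto intro: less_imp_le)
    also have "\<dots> \<le> vec_norm2 (Y ^\<^sub>m (2 ^ k) *\<^sub>v u)"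
      unfolding a_def by (rule hermitian_power_growth[OF Y u])
    also have "\<dots> \<le> sqrt (real n) * (real n * b)"
      using Y u b b0 by (intro vec_norm2_mult_le_norm_bound) auto
    finally show False using k by simp
  qed
  then have "vec_norm2 (X *\<^sub>v u) \<le> r"
    by (rule dense_ge)
  moreover have "X *\<^sub>v u = complex_of_real (1 / vec_norm2 x) \<cdot>\<^sub>v (X *\<^sub>v x)"
    using X x by (simp add: u_def mult_mat_vec)
  ultimately show ?thesis
    using nx by (simp add: vec_norm2_smult norm_divide field_simps)
qed

section \<open>Inverses and lower bounds\<close>

lemma obtain_inverse_if_not_eigenvalue_0:
  fixes A :: "complex mat"
  assumes A: "A \<in> carrier_mat n n" and ker: "\<not> eigenvalue A 0"
  obtains B where "B \<in> carrier_mat n n" "A * B = 1\<^sub>m n" "B * A = 1\<^sub>m n"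
proof -
  have "det A \<noteq> 0"
    using A ker by (fastforce simp: det_0_iff_vec_prod_zero_field[OF A] eigenvalue_def eigenvector_def)
  from det_non_zero_imp_unit[OF A this, of "()"] show ?thesis
    using that by (auto simp: Units_def ring_mat_def)
qed

lemma invertible_mat_mat_inverse:
  fixes T :: "complex mat"
  assumes inv: "invertible_mat T" and T: "T \<in> carrier_mat k k"
  shows "the (mat_inverse T) \<in> carrier_mat k k"
    "T * the (mat_inverse T) = 1\<^sub>m k" "the (mat_inverse T) * T = 1\<^sub>m k"
proof -
  from inv obtain Y where Y: "T * Y = 1\<^sub>m k" "Y * T = 1\<^sub>m (dim_row Y)"
    using T by (auto simp: invertible_mat_def inverts_mat_def)
  then have "Y \<in> carrier_mat k k"
    using T by (metis carrier_matD(2) carrier_matI index_mult_mat(3) index_one_mat(3))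
  with Y T have "T \<in> Units (ring_mat TYPE(complex) k ())"
    by (auto simp: Units_def ring_mat_def)
  then have "mat_inverse T \<noteq> None"
    using mat_inverse(1)[OF T, of "()"] by blast
  then have "mat_inverse T = Some (the (mat_inverse T))" by auto
  from mat_inverse(2)[OF T this]
  show "the (mat_inverse T) \<in> carrier_mat k k"
    "T * the (mat_inverse T) = 1\<^sub>m k" "the (mat_inverse T) * T = 1\<^sub>m k" by auto
qed

lemma mat_adjoint_inverse:
  fixes A :: "complex mat"
  assumes A: "A \<in> carrier_mat n n" "mat_adjoint A = A"
    and B: "B \<in> carrier_mat n n" "A * B = 1\<^sub>m n" "B * A = 1\<^sub>m n"
  shows "mat_adjoint B = B"
proof -
  have "mat_adjoint B * A = mat_adjoint (A * B)"
    using A mat_adjoint_mult[OF A(1) B(1)] by simp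
  then have *: "mat_adjoint B * A = 1\<^sub>m n" using B by simp
  have "mat_adjoint B = mat_adjoint B * (A * B)"
    using B by simp
  also have "\<dots> = (mat_adjoint B * A) * B"
    using A B by (simp add: assoc_mult_mat[of _ n n _ n _ n])
  finally show ?thesis using * B by simp
qed

text \<open>
  The eigenvalues of the inverse $Y$ are the reciprocals of those of $X$, so that the upper bound
  by the spectral radius of $Y$ becomes a bound by the smallest modulus of an eigenvalue of $X$.
\<close>
lemma hermitian_inverse_norm_le:
  fixes X :: "complex mat"
  assumes X: "X \<in> carrier_mat n n" "mat_adjoint X = X"
    and Y: "Y \<in> carrier_mat n n" "X * Y = 1\<^sub>m n" "Y * X = 1\<^sub>m n"
    and r: "0 < r" "\<And>d. eigenvalue X d \<Longrightarrow> r \<le> cmod d"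
    and x: "x \<in> carrier_vec n"
  shows "vec_norm2 (Y *\<^sub>v x) \<le> vec_norm2 x / r"
proof -
  have "cmod d \<le> 1 / r" if ev: "eigenvalue Y d" for d
  proof -
    obtain u where u: "u \<in> carrier_vec n" "u \<noteq> 0\<^sub>v n" "Y *\<^sub>v u = d \<cdot>\<^sub>v u"
      using ev Y by (auto simp: eigenvalue_def eigenvector_def)
    have "X *\<^sub>v (Y *\<^sub>v u) = u"
      using X Y u by (metis assoc_mult_mat_vec one_mult_mat_vec)
    then have ud: "u = d \<cdot>\<^sub>v (X *\<^sub>v u)"
      using X u by (simp add: mult_mat_vec)
    have d: "d \<noteq> 0"
    proof
      assume "d = 0"
      with ud have "u = 0\<^sub>v n" using X u by (simp add: smult_zero_vec_left)
      with u show False by simp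
    qed
    have "(1 / d) \<cdot>\<^sub>v u = (1 / d) \<cdot>\<^sub>v (d \<cdot>\<^sub>v (X *\<^sub>v u))"
      using ud by simp
    then have "X *\<^sub>v u = (1 / d) \<cdot>\<^sub>v u"
      using d by (simp add: smult_smult_assoc)
    with u X have "eigenvalue X (1 / d)"
      by (auto simp: eigenvalue_def eigenvector_def)
    from r(2)[OF this] show ?thesis
      using d r(1) by (simp add: norm_divide field_simps)
  qed
  then have "vec_norm2 (Y *\<^sub>v x) \<le> 1 / r * vec_norm2 x"
    by (intro hermitian_norm_le_spectral[OF Y(1) mat_adjoint_inverse[OF X Y] _ x])
  then show ?thesis by simp
qed

text \<open>
  With $y = Mx$, Cauchy-Schwarz for the form $M$ reads
  $\|y\|^4 = |y^*Mx|^2 \le (x^*Mx)(y^*My)$, and $y^*My \le b\,\|y\|^2$; one factor $\|y\|^2$ cancels.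
\<close>
lemma pos_def_norm_sq_le:
  fixes M :: "complex mat"
  assumes pd: "hermitian_pos_def M" and M: "M \<in> carrier_mat n n"
    and b: "\<And>d. eigenvalue M d \<Longrightarrow> cmod d \<le> b"
    and x: "x \<in> carrier_vec n"
  shows "(vec_norm2 (M *\<^sub>v x))\<^sup>2 \<le> b * Re ((M *\<^sub>v x) \<bullet>c x)"
proof (cases "vec_norm2 (M *\<^sub>v x) = 0")
  case True
  then have "M *\<^sub>v x = 0\<^sub>v n" using M x vec_norm2_eq_0[of "M *\<^sub>v x" n] by simp
  with True x show ?thesis by simp
next
  case False
  note herm = hermitian_pos_def_carrier[OF pd M]
  define y where "y = M *\<^sub>v x"
  define q where "q = Re ((M *\<^sub>v x) \<bullet>c x)"
  have y: "y \<in> carrier_vec n" using M x by (simp add: y_def)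
  have q: "0 \<le> q" using herm(3)[OF x] by (simp add: q_def)
  have "Re ((M *\<^sub>v y) \<bullet>c y) \<le> cmod ((M *\<^sub>v y) \<bullet>c y)" by (rule complex_Re_le_cmod)
  also have "\<dots> \<le> vec_norm2 (M *\<^sub>v y) * vec_norm2 y"
    using M y by (intro Cauchy_Schwarz_vec) auto
  also have "\<dots> \<le> b * vec_norm2 y * vec_norm2 y"
    using b by (intro mult_right_mono hermitian_norm_le_spectral[OF M herm(1) _ y]) auto
  finally have My: "Re ((M *\<^sub>v y) \<bullet>c y) \<le> b * (vec_norm2 y)\<^sup>2"
    by (simp add: power2_eq_square mult.assoc)
  have "(vec_norm2 y)\<^sup>2 * (vec_norm2 y)\<^sup>2 = (cmod ((M *\<^sub>v x) \<bullet>c y))\<^sup>2"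
    unfolding y_def[symmetric] by (simp add: cscalar_prod_self power2_eq_square norm_mult)
  also have "\<dots> \<le> q * Re ((M *\<^sub>v y) \<bullet>c y)"
    unfolding q_def by (rule Cauchy_Schwarz_pos_def[OF pd M x y])
  also have "\<dots> \<le> q * (b * (vec_norm2 y)\<^sup>2)"
    using My q by (rule mult_left_mono)
  finally have "(vec_norm2 y)\<^sup>2 * (vec_norm2 y)\<^sup>2 \<le> (b * q) * (vec_norm2 y)\<^sup>2"
    by (simp add: mult_ac)
  moreover have "(vec_norm2 y)\<^sup>2 > 0" using False by (simp add: y_def)
  ultimately have "(vec_norm2 y)\<^sup>2 \<le> b * q"
    by (meson mult_le_cancel_right_pos)
  then show ?thesis by (simp add: y_def q_def)
qed

text \<open>
  The same argument with $y = M^{-1}x$: here $\|x\|^4 = |x^*My|^2 \le (y^*My)(x^*Mx)$ and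
  $y^*My = y^*x \le \|x\|^2/r$.
\<close>
lemma pos_def_quadratic_form_ge:
  fixes M :: "complex mat"
  assumes pd: "hermitian_pos_def M" and M: "M \<in> carrier_mat n n"
    and r: "0 < r" "\<And>d. eigenvalue M d \<Longrightarrow> r \<le> cmod d"
    and x: "x \<in> carrier_vec n"
  shows "r * (vec_norm2 x)\<^sup>2 \<le> Re ((M *\<^sub>v x) \<bullet>c x)"
proof (cases "x = 0\<^sub>v n")
  case True
  with M x show ?thesis by simp
next
  case False
  note herm = hermitian_pos_def_carrier[OF pd M]
  have "\<not> eigenvalue M 0" using r by force
  then obtain Y where Y: "Y \<in> carrier_mat n n" "M * Y = 1\<^sub>m n" "Y * M = 1\<^sub>m n"
    using obtain_inverse_if_not_eigenvalue_0[OF M] by blast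
  define y where "y = Y *\<^sub>v x"
  define q where "q = Re ((M *\<^sub>v x) \<bullet>c x)"
  have y: "y \<in> carrier_vec n" using Y x by (simp add: y_def)
  have My: "M *\<^sub>v y = x"
    unfolding y_def using M Y x by (metis assoc_mult_mat_vec one_mult_mat_vec)
  have q: "0 \<le> q" using herm(3)[OF x] by (simp add: q_def)
  have nx: "(vec_norm2 x)\<^sup>2 > 0" using False vec_norm2_eq_0[OF x] by simp
  have "Re (x \<bullet>c y) \<le> vec_norm2 x * vec_norm2 y"
    using complex_Re_le_cmod[of "x \<bullet>c y"] Cauchy_Schwarz_vec[OF x y] by linarith
  also have "\<dots> \<le> vec_norm2 x * (vec_norm2 x / r)"
    unfolding y_def
    by (intro mult_left_mono hermitian_inverse_norm_le[OF M herm(1) Y r x]) auto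
  finally have xy: "Re (x \<bullet>c y) \<le> (vec_norm2 x)\<^sup>2 / r"
    by (simp add: power2_eq_square)
  have "(vec_norm2 x)\<^sup>2 * (vec_norm2 x)\<^sup>2 = (cmod ((M *\<^sub>v y) \<bullet>c x))\<^sup>2"
    unfolding My by (simp add: cscalar_prod_self power2_eq_square norm_mult)
  also have "\<dots> \<le> Re (x \<bullet>c y) * q"
    using Cauchy_Schwarz_pos_def[OF pd M y x] by (simp add: My q_def)
  also have "\<dots> \<le> (vec_norm2 x)\<^sup>2 / r * q"
    using xy q by (rule mult_right_mono)
  finally have "(vec_norm2 x)\<^sup>2 * (vec_norm2 x)\<^sup>2 \<le> (q / r) * (vec_norm2 x)\<^sup>2"
    by (simp add: mult_ac)
  then have "(vec_norm2 x)\<^sup>2 \<le> q / r"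
    using nx by (meson mult_le_cancel_right_pos)
  with r show ?thesis by (simp add: q_def field_simps)
qed

text \<open>
  Strict positivity of $|\lambda_{\min}(T)|$ matters because it is the denominator of $\kappa$, and
  division by zero yields zero.
\<close>
lemma hermitian_min_eigenvalue_norm_le:
  fixes T :: "complex mat"
  assumes T: "T \<in> carrier_mat k k" "mat_adjoint T = T" and inv: "invertible_mat T"
    and z: "z \<in> carrier_vec k" "z \<noteq> 0\<^sub>v k"
  shows "0 < cmod (eig_min T)" "cmod (eig_min T) * vec_norm2 z \<le> vec_norm2 (T *\<^sub>v z)"
proof -
  have k: "k > 0" using z by (cases k) auto
  have fin: "finite (spectrum T)" and ne: "spectrum T \<noteq> {}"
    using card_finite_spectrum[OF T(1)] spectrum_non_empty[OF T(1) k] by auto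
  have "\<exists>d. is_arg_min cmod (eigenvalue T) d"
  proof -
    obtain d where "d \<in> spectrum T" "\<And>d'. d' \<in> spectrum T \<Longrightarrow> cmod d \<le> cmod d'"
      using arg_min_if_finite(1)[OF fin ne, of cmod] arg_min_least[OF fin ne, of _ cmod] by blast
    then show ?thesis
      by (auto simp: spectrum_def is_arg_min_linorder)
  qed
  then have "is_arg_min cmod (eigenvalue T) (eig_min T)"
    unfolding eig_min_def arg_min_def by (rule someI_ex)
  then have ev: "eigenvalue T (eig_min T)"
    and least: "\<And>d. eigenvalue T d \<Longrightarrow> cmod (eig_min T) \<le> cmod d"
    by (auto simp: is_arg_min_linorder)
  obtain Y where Y: "Y \<in> carrier_mat k k" "T * Y = 1\<^sub>m k" "Y * T = 1\<^sub>m k"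
    using invertible_mat_mat_inverse[OF inv T(1)] by blast
  have YT: "Y *\<^sub>v (T *\<^sub>v x) = x" if "x \<in> carrier_vec k" for x
    using T Y that by (metis assoc_mult_mat_vec one_mult_mat_vec)
  show pos: "0 < cmod (eig_min T)"
  proof (rule ccontr)
    assume "\<not> ?thesis"
    then have "eigenvalue T 0" using ev by simp
    then obtain x where x: "x \<in> carrier_vec k" "x \<noteq> 0\<^sub>v k" "T *\<^sub>v x = 0 \<cdot>\<^sub>v x"
      using T by (auto simp: eigenvalue_def eigenvector_def)
    have "0 \<cdot>\<^sub>v x = 0\<^sub>v k" using x by auto
    with YT[OF x(1)] x Y show False by auto
  qed
  have "vec_norm2 (Y *\<^sub>v (T *\<^sub>v z)) \<le> vec_norm2 (T *\<^sub>v z) / cmod (eig_min T)"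
    using T z by (intro hermitian_inverse_norm_le[OF T Y pos least]) auto
  then show "cmod (eig_min T) * vec_norm2 z \<le> vec_norm2 (T *\<^sub>v z)"
    using pos z by (simp add: YT field_simps)
qed

section \<open>Singular values and the condition number\<close>

lemma finite_singular_values: "finite (singular_values H)"
proof -
  have "finite (spectrum (mat_adjoint H * H))"
    by (rule card_finite_spectrum(1)[of _ "dim_col H"]) auto
  then have "finite ((\<lambda>d. sqrt (Re d)) ` spectrum (mat_adjoint H * H))" by simp
  moreover have "singular_values H \<subseteq> (\<lambda>d. sqrt (Re d)) ` spectrum (mat_adjoint H * H)"
  proof
    fix s assume "s \<in> singular_values H"
    then have "s = sqrt (Re (complex_of_real (s\<^sup>2)))"
      "complex_of_real (s\<^sup>2) \<in> spectrum (mat_adjoint H * H)"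
      by (auto simp: singular_values_def spectrum_def)
    then show "s \<in> (\<lambda>d. sqrt (Re d)) ` spectrum (mat_adjoint H * H)" by blast
  qed
  ultimately show ?thesis by (rule finite_subset[rotated])
qed

text \<open>
  This is where $\sqrt{\mathrm{cond}(H)}$ enters. Because $H^*H = M^2$, the modulus of every
  eigenvalue of $M$ is a singular value of $H$ and lies in $[r, b]$, with $r$ and $b$ the extreme singular
  values. Then $\|Mw\|^2 \le b\,q$ and $r \le q$ for $q = w^*Mw$, whence
  $\|Mw\|^2 \le (b/r)\,q^2$.
\<close>
lemma pos_def_norm_le_sqrt_cond2:
  fixes M :: "complex mat"
  assumes pd: "hermitian_pos_def M" and M: "M \<in> carrier_mat n n"
    and HH: "mat_adjoint H * H = M * M"
    and w: "w \<in> carrier_vec n" "vec_norm2 w = 1"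
  shows "vec_norm2 (M *\<^sub>v w) \<le> sqrt (cond2 H) * Re ((M *\<^sub>v w) \<bullet>c w)"
proof -
  note herm = hermitian_pos_def_carrier[OF pd M]
  define b where "b = Max (singular_values H)"
  define r where "r = Min (singular_values H)"
  define q where "q = Re ((M *\<^sub>v w) \<bullet>c w)"
  have w0: "w \<noteq> 0\<^sub>v n" using w by auto
  then have n: "n > 0" using w by (cases n) auto
  have q: "0 < q" unfolding q_def using herm(2) w w0 by simp
  have mem: "cmod d \<in> singular_values H" if ev: "eigenvalue M d" for d
  proof -
    obtain x where x: "x \<in> carrier_vec n" "x \<noteq> 0\<^sub>v n" "M *\<^sub>v x = d \<cdot>\<^sub>v x"
      using ev M by (auto simp: eigenvalue_def eigenvector_def)
    have "d \<in> \<real>"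
      using ev eigenvalue_hermitian_real[OF M herm(1)] by (auto simp: eigenvalue_def)
    then have "complex_of_real ((cmod d)\<^sup>2) = d * d"
      by (metis Reals_cnj_iff complex_norm_square)
    moreover have "(M * M) *\<^sub>v x = (d * d) \<cdot>\<^sub>v x"
      using M x by (simp add: assoc_mult_mat_vec[of _ n n _ n] mult_mat_vec[of _ n n] smult_smult_assoc)
    ultimately show ?thesis
      using x M by (auto simp: singular_values_def HH eigenvalue_def eigenvector_def simp del: of_real_power)
  qed
  obtain d where "eigenvalue M d"
    using spectrum_non_empty[OF M n] by (auto simp: spectrum_def)
  then have ne: "singular_values H \<noteq> {}" using mem by blast
  have bnd: "r \<le> cmod d" "cmod d \<le> b" if "eigenvalue M d" for d
    using mem[OF that] finite_singular_values by (auto simp: r_def b_def)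
  have r: "0 < r"
  proof -
    have "r \<in> singular_values H"
      unfolding r_def by (rule Min_in[OF finite_singular_values ne])
    then obtain x where x: "x \<in> carrier_vec n" "x \<noteq> 0\<^sub>v n"
        "(M * M) *\<^sub>v x = complex_of_real (r\<^sup>2) \<cdot>\<^sub>v x" and r0: "0 \<le> r"
      using M by (auto simp: singular_values_def HH eigenvalue_def eigenvector_def)
    have "M *\<^sub>v y \<noteq> 0\<^sub>v n" if "y \<in> carrier_vec n" "y \<noteq> 0\<^sub>v n" for y
      using herm(2)[OF that] that by force
    then have "M *\<^sub>v (M *\<^sub>v x) \<noteq> 0\<^sub>v n"
      using M x by (meson mult_mat_vec_carrier)
    moreover have "M *\<^sub>v (M *\<^sub>v x) = complex_of_real (r\<^sup>2) \<cdot>\<^sub>v x"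
      using M x by (simp add: assoc_mult_mat_vec[of _ n n _ n])
    moreover have "0 \<cdot>\<^sub>v x = 0\<^sub>v n" using x by auto
    ultimately have "r \<noteq> 0" by auto
    with r0 show ?thesis by simp
  qed
  have "r \<le> q"
    using pos_def_quadratic_form_ge[OF pd M r bnd(1) w(1)] w by (simp add: q_def)
  have "b \<ge> 0"
    using order_trans[OF norm_ge_zero bnd(2)] \<open>eigenvalue M d\<close> by blast
  have "(vec_norm2 (M *\<^sub>v w))\<^sup>2 \<le> b * q"
    unfolding q_def by (rule pos_def_norm_sq_le[OF pd M bnd(2) w(1)])
  also have "\<dots> \<le> b * q * (q / r)"
    using mult_left_mono[of 1 "q / r" "b * q"] \<open>r \<le> q\<close> \<open>b \<ge> 0\<close> q r by simp
  also have "\<dots> = (sqrt (cond2 H) * q)\<^sup>2"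
  proof -
    have "(sqrt (cond2 H))\<^sup>2 = b / r"
      using \<open>b \<ge> 0\<close> r by (simp add: cond2_def flip: b_def r_def)
    then show ?thesis by (simp add: power_mult_distrib power2_eq_square[of q])
  qed
  finally have sq: "(vec_norm2 (M *\<^sub>v w))\<^sup>2 \<le> (sqrt (cond2 H) * q)\<^sup>2" .
  have "0 \<le> cond2 H"
    using \<open>b \<ge> 0\<close> r by (simp add: cond2_def flip: b_def r_def)
  with q have "0 \<le> sqrt (cond2 H) * q" by simp
  with sq show ?thesis
    unfolding q_def by (rule power2_le_imp_le)
qed

section \<open>Orthonormal columns and the projected pencil\<close>

lemma vec_norm2_isometry:
  fixes Q :: "complex mat"
  assumes Q: "Q \<in> carrier_mat n k" "mat_adjoint Q * Q = 1\<^sub>m k" and z: "z \<in> carrier_vec k"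
  shows "vec_norm2 (Q *\<^sub>v z) = vec_norm2 z"
proof -
  have "(Q *\<^sub>v z) \<bullet>c (Q *\<^sub>v z) = z \<bullet>c (mat_adjoint Q *\<^sub>v (Q *\<^sub>v z))"
    using cscalar_prod_adjoint[OF Q(1) z] Q z by simp
  also have "mat_adjoint Q *\<^sub>v (Q *\<^sub>v z) = z"
    using Q z by (metis assoc_mult_mat_vec mat_adjoint_carrier one_mult_mat_vec)
  finally have "(vec_norm2 (Q *\<^sub>v z))\<^sup>2 = (vec_norm2 z)\<^sup>2"
    by (simp add: cscalar_prod_self flip: of_real_power)
  then show ?thesis by (simp add: power2_eq_iff_nonneg)
qed

text \<open>$\|Q^*u\|^2 = u^*(QQ^*u) \le \|u\|\,\|QQ^*u\| = \|u\|\,\|Q^*u\|$.\<close>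
lemma vec_norm2_adjoint_isometry_le:
  fixes Q :: "complex mat"
  assumes Q: "Q \<in> carrier_mat n k" "mat_adjoint Q * Q = 1\<^sub>m k" and u: "u \<in> carrier_vec n"
  shows "vec_norm2 (mat_adjoint Q *\<^sub>v u) \<le> vec_norm2 u"
proof -
  define y where "y = mat_adjoint Q *\<^sub>v u"
  have y: "y \<in> carrier_vec k"
    using mult_mat_vec_carrier[OF mat_adjoint_carrier[OF Q(1)] u] by (simp add: y_def)
  have "(vec_norm2 y)\<^sup>2 = cmod ((Q *\<^sub>v y) \<bullet>c u)"
    using cscalar_prod_adjoint[OF Q(1) y u] by (simp add: cscalar_prod_self norm_power flip: y_def)
  also have "\<dots> \<le> vec_norm2 y * vec_norm2 u"
    using Cauchy_Schwarz_vec[of "Q *\<^sub>v y" n u] vec_norm2_isometry[OF Q y] Q u y by auto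
  finally have "vec_norm2 y * vec_norm2 y \<le> vec_norm2 u * vec_norm2 y"
    by (simp add: power2_eq_square mult.commute)
  then show ?thesis
    unfolding y_def[symmetric] using vec_norm2_nonneg[of y] vec_norm2_nonneg[of u]
    by (cases "vec_norm2 y = 0") (auto simp: mult_le_cancel_right)
qed

lemma hermitian_compression:
  fixes S Q :: "complex mat"
  assumes S: "S \<in> carrier_mat n n" "mat_adjoint S = S" and Q: "Q \<in> carrier_mat n k"
  shows "mat_adjoint (mat_adjoint Q * S * Q) = mat_adjoint Q * S * Q"
proof -
  have Qa: "mat_adjoint Q \<in> carrier_mat k n" using Q by simp
  have "mat_adjoint (mat_adjoint Q * S * Q) = mat_adjoint Q * mat_adjoint (mat_adjoint Q * S)"
    using Qa S(1) by (intro mat_adjoint_mult[OF _ Q]) auto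
  also have "mat_adjoint (mat_adjoint Q * S) = S * Q"
    using mat_adjoint_mult[OF Qa S(1)] S(2) by simp
  finally show ?thesis
    by (simp only: assoc_mult_mat[OF Qa S(1) Q])
qed

text \<open>
  The Rayleigh quotient is $G = T^{-1}Q^*SHQ$ because $T$ and its inverse are hermitian.
  Multiplying $Gz = \tilde\lambda z$ by $T$ clears the inverse.
\<close>
lemma ritz_pair_projected_pencil:
  fixes H S Q :: "complex mat"
  assumes S: "S \<in> carrier_mat n n" "mat_adjoint S = S"
    and H: "H \<in> carrier_mat n n" and Q: "Q \<in> carrier_mat n k"
    and inv: "invertible_mat (mat_adjoint Q * S * Q)"
    and z: "eigenvector (rayleigh_quotient H S Q) z mu"
  shows "z \<in> carrier_vec k"
    "mat_adjoint Q *\<^sub>v ((S * H) *\<^sub>v (Q *\<^sub>v z)) = mu \<cdot>\<^sub>v ((mat_adjoint Q * S * Q) *\<^sub>v z)"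
proof -
  define T where "T = mat_adjoint Q * S * Q"
  have Qa: "mat_adjoint Q \<in> carrier_mat k n" using Q by simp
  have T: "T \<in> carrier_mat k k"
    unfolding T_def using Qa Q S by (intro mult_carrier_mat[of _ k n] mult_carrier_mat[of _ k n]) auto
  have Th: "mat_adjoint T = T"
    unfolding T_def by (rule hermitian_compression[OF S(1,2) Q])
  define X where "X = the (mat_inverse T)"
  have X: "X \<in> carrier_mat k k" "T * X = 1\<^sub>m k" "X * T = 1\<^sub>m k"
    using invertible_mat_mat_inverse[OF _ T] inv by (auto simp: X_def T_def)
  have Xh: "mat_adjoint X = X" by (rule mat_adjoint_inverse[OF T Th X])
  define G where "G = rayleigh_quotient H S Q"
  have "mat_adjoint (S * Q * X) = X * (mat_adjoint Q * S)"
    using S Q X Xh by (simp add: mat_adjoint_mult[of _ n k _ k] mat_adjoint_mult[of _ n n _ k]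
        assoc_mult_mat[of _ k k _ n _ n])
  then have G: "G = X * (mat_adjoint Q * S) * H * Q"
    by (simp add: G_def rayleigh_quotient_def dual_basis_def flip: T_def X_def)
  have Gc: "G \<in> carrier_mat k k"
    unfolding G using X(1) Qa S(1) H Q
    by (intro mult_carrier_mat[of _ k n] mult_carrier_mat[of _ k k]) auto
  show zc: "z \<in> carrier_vec k"
    using z Gc by (auto simp: eigenvector_def simp flip: G_def)
  have Gz: "G *\<^sub>v z = mu \<cdot>\<^sub>v z"
    using z by (simp add: eigenvector_def flip: G_def)
  define u where "u = mat_adjoint Q *\<^sub>v ((S * H) *\<^sub>v (Q *\<^sub>v z))"
  have uc: "u \<in> carrier_vec k"
    unfolding u_def using S H Q zc by (intro mult_mat_vec_carrier[OF Qa]) auto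
  have "G *\<^sub>v z = (X * (mat_adjoint Q * S)) *\<^sub>v (H *\<^sub>v (Q *\<^sub>v z))"
    unfolding G using mult_carrier_mat[OF X(1) mult_carrier_mat[OF Qa S(1)]] H Q zc
    by (simp add: assoc_mult_mat_vec[of _ k n "H * Q" k] assoc_mult_mat_vec[of H n n Q k])
  also have "\<dots> = X *\<^sub>v u"
    unfolding u_def using X(1) Qa S(1) mult_carrier_mat[OF Qa S(1)] H Q zc
      mult_mat_vec_carrier[OF Q zc]
    by (simp add: assoc_mult_mat_vec[of X k k _ n] assoc_mult_mat_vec[of _ k n S n]
        assoc_mult_mat_vec[of S n n H n])
  finally have "G *\<^sub>v z = X *\<^sub>v u" .
  then have "T *\<^sub>v (X *\<^sub>v u) = T *\<^sub>v (mu \<cdot>\<^sub>v z)" using Gz by simp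
  moreover have "T *\<^sub>v (X *\<^sub>v u) = u"
    using T X uc by (metis assoc_mult_mat_vec one_mult_mat_vec)
  ultimately show "mat_adjoint Q *\<^sub>v ((S * H) *\<^sub>v (Q *\<^sub>v z)) = mu \<cdot>\<^sub>v ((mat_adjoint Q * S * Q) *\<^sub>v z)"
    using T zc by (simp add: mult_mat_vec flip: u_def T_def)
qed

section \<open>The structured matrices\<close>

lemma H_mat_carrier:
  assumes "A \<in> carrier_mat m m" "B \<in> carrier_mat m m"
  shows "H_mat A B \<in> carrier_mat (2 * m) (2 * m)"
  using assms unfolding H_mat_def mult_2 by (intro four_block_carrier_mat) auto

lemma S_mat_carrier: "S_mat m \<in> carrier_mat (2 * m) (2 * m)"
  unfolding S_mat_def mult_2 by (intro four_block_carrier_mat) auto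

lemma S_mat_adjoint: "mat_adjoint (S_mat m) = S_mat m"
  by (rule eq_matI) (auto simp: S_mat_def)

lemma S_mat_square: "S_mat m * S_mat m = 1\<^sub>m (2 * m)"
proof -
  have neg0: "- 0\<^sub>m m m = (0\<^sub>m m m :: complex mat)"
    by (rule eq_matI) auto
  have "S_mat m * S_mat m = four_block_mat (1\<^sub>m m) (0\<^sub>m m m) (0\<^sub>m m m) (1\<^sub>m m)"
    unfolding S_mat_def
    by (subst mult_four_block_mat[of _ m m _ m _ m _ _ m _ m]) (auto simp: neg0)
  then show ?thesis by (simp add: mult_2)
qed

section \<open>The quadratic error bound\<close>

text \<open>
  $\lambda\, v^*Sv = v^*Mv$ is a real positive number and $v^*Sv$ is real. The indefiniteness of $S$
  does no harm, since $v^*Sv$ cannot vanish.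
\<close>
lemma definite_pencil_eigenvalue_real:
  fixes M S :: "complex mat"
  assumes pd: "hermitian_pos_def M" and M: "M \<in> carrier_mat n n"
    and S: "S \<in> carrier_mat n n" "mat_adjoint S = S"
    and v: "v \<in> carrier_vec n" "v \<noteq> 0\<^sub>v n" "M *\<^sub>v v = lam \<cdot>\<^sub>v (S *\<^sub>v v)"
  shows "lam \<in> \<real>"
proof -
  note herm = hermitian_pos_def_carrier[OF pd M]
  have "lam * ((S *\<^sub>v v) \<bullet>c v) = (M *\<^sub>v v) \<bullet>c v"
    using v S by simp
  moreover have "(M *\<^sub>v v) \<bullet>c v \<in> \<real>" "(S *\<^sub>v v) \<bullet>c v \<in> \<real>"
    using cscalar_prod_hermitian_real[OF M herm(1) v(1)] cscalar_prod_hermitian_real[OF S v(1)]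
    by (metis Reals_of_real)+
  moreover have "(M *\<^sub>v v) \<bullet>c v \<noteq> 0"
    using herm(2)[OF v(1,2)] by force
  ultimately show ?thesis
    by (metis Reals_divide mult_zero_right nonzero_mult_div_cancel_right)
qed

text \<open>
  The source of the quadratic convergence: both terms linear in $\sigma$ contain $Kv$ or, as $K$ is
  hermitian, its adjoint, and vanish.
\<close>
lemma quadratic_form_kernel_perturbation:
  fixes K :: "complex mat"
  assumes K: "K \<in> carrier_mat n n" "mat_adjoint K = K"
    and v: "v \<in> carrier_vec n" "K *\<^sub>v v = 0\<^sub>v n" and e: "e \<in> carrier_vec n"
    and w: "w = \<gamma> \<cdot>\<^sub>v v + \<sigma> \<cdot>\<^sub>v e"
  shows "(K *\<^sub>v w) \<bullet>c w = complex_of_real ((cmod \<sigma>)\<^sup>2) * ((K *\<^sub>v e) \<bullet>c e)"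
proof -
  have Ke: "K *\<^sub>v e \<in> carrier_vec n" using K e by auto
  have "K *\<^sub>v w = \<gamma> \<cdot>\<^sub>v (K *\<^sub>v v) + \<sigma> \<cdot>\<^sub>v (K *\<^sub>v e)"
    using K v(1) e by (simp add: w mult_add_distrib_mat_vec mult_mat_vec)
  also have "\<dots> = \<sigma> \<cdot>\<^sub>v (K *\<^sub>v e)"
    using Ke by (simp add: v(2) smult_zero_vec_right)
  finally have Kw: "K *\<^sub>v w = \<sigma> \<cdot>\<^sub>v (K *\<^sub>v e)" .
  have "(K *\<^sub>v e) \<bullet>c v = e \<bullet>c (K *\<^sub>v v)"
    using cscalar_prod_adjoint[OF K(1) e v(1)] K(2) by simp
  then have Kev: "(K *\<^sub>v e) \<bullet>c v = 0" using e by (simp add: v(2))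
  have cw: "conjugate w = cnj \<gamma> \<cdot>\<^sub>v conjugate v + cnj \<sigma> \<cdot>\<^sub>v conjugate e"
    using v e by (simp add: w conjugate_add_vec[of _ n] conjugate_smult_vec)
  have "(K *\<^sub>v w) \<bullet>c w = \<sigma> * cnj \<sigma> * ((K *\<^sub>v e) \<bullet>c e)"
    unfolding Kw cw using Ke v e by (simp add: scalar_prod_add_distrib[of _ n] Kev)
  then show ?thesis by (simp only: complex_norm_square)
qed

text \<open>
  What the argument takes from the block structure is that $S$ is a hermitian isometry: this gives
  $H^*H = M^2$ for $M = SH$ and $|e^*Ke| = |(Se)^*(H - \lambda I)e| \le \|H - \lambda I\|_2$.
\<close>
lemma ritz_value_quadratic_bound:
  fixes H S Q :: "complex mat"
  assumes S: "S \<in> carrier_mat n n" "mat_adjoint S = S" "S * S = 1\<^sub>m n"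
    and H: "H \<in> carrier_mat n n" and pd: "hermitian_pos_def (S * H)"
    and Q: "Q \<in> carrier_mat n k" "mat_adjoint Q * Q = 1\<^sub>m k"
    and inv: "invertible_mat (mat_adjoint Q * S * Q)"
    and ritz: "ritz_pair H S Q mu w"
    and v: "eigenvector H v lam"
    and e: "e \<in> carrier_vec n" "vec_norm2 e = 1"
    and w: "w = \<gamma> \<cdot>\<^sub>v v + \<sigma> \<cdot>\<^sub>v e"
  shows "cmod (lam - mu) \<le> kappa H S Q lam * (cmod \<sigma>)\<^sup>2"
proof -
  define M where "M = S * H"
  define T where "T = mat_adjoint Q * S * Q"
  define L where "L = H - lam \<cdot>\<^sub>m 1\<^sub>m n"
  define K where "K = S * L"
  have M: "M \<in> carrier_mat n n" using S H by (simp add: M_def)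
  have pdM: "hermitian_pos_def M" using pd by (simp add: M_def)
  note herm = hermitian_pos_def_carrier[OF pdM M]
  have Qa: "mat_adjoint Q \<in> carrier_mat k n" using Q by simp
  have T: "T \<in> carrier_mat k k"
    unfolding T_def using Qa Q S by (intro mult_carrier_mat[of _ k n] mult_carrier_mat[of _ k n]) auto
  have Th: "mat_adjoint T = T"
    unfolding T_def by (rule hermitian_compression[OF S(1,2) Q(1)])
  have L: "L \<in> carrier_mat n n"
    unfolding L_def by (intro minus_carrier_mat smult_carrier_mat one_carrier_mat)
  have K: "K \<in> carrier_mat n n" using S L by (simp add: K_def)
  obtain z where z: "eigenvector (rayleigh_quotient H S Q) z mu" and wz: "w = Q *\<^sub>v z"
    and w1: "vec_norm2 w = 1"
    using ritz by (auto simp: ritz_pair_def)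
  note pencil = ritz_pair_projected_pencil[OF S(1,2) H Q(1) inv z]
  have zc: "z \<in> carrier_vec k" by (rule pencil(1))
  have wc: "w \<in> carrier_vec n" using Q zc by (auto simp: wz)
  have z1: "vec_norm2 z = 1" using vec_norm2_isometry[OF Q zc] w1 by (simp add: wz)
  then have z0: "z \<noteq> 0\<^sub>v k" by auto
  have Tz: "mat_adjoint Q *\<^sub>v (M *\<^sub>v w) = mu \<cdot>\<^sub>v (T *\<^sub>v z)"
    using pencil(2) by (simp add: M_def T_def wz)
  have Tz': "T *\<^sub>v z = mat_adjoint Q *\<^sub>v (S *\<^sub>v w)"
    using Qa Q S zc mult_carrier_mat[OF Qa S(1)]
    by (simp add: T_def wz assoc_mult_mat_vec[of _ k n Q k] assoc_mult_mat_vec[of _ k n S n])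
  define s where "s = (S *\<^sub>v w) \<bullet>c w"
  have Mw: "M *\<^sub>v w \<in> carrier_vec n" and Sw: "S *\<^sub>v w \<in> carrier_vec n" using M S wc by auto
  have proj: "(mat_adjoint Q *\<^sub>v u) \<bullet>c z = u \<bullet>c w" if "u \<in> carrier_vec n" for u
    using cscalar_prod_adjoint[OF Qa that zc] by (simp add: wz)
  have Mww: "(M *\<^sub>v w) \<bullet>c w = mu * s"
  proof -
    have "(M *\<^sub>v w) \<bullet>c w = (mu \<cdot>\<^sub>v (T *\<^sub>v z)) \<bullet>c z"
      using proj[OF Mw] Tz by simp
    also have "\<dots> = mu * ((T *\<^sub>v z) \<bullet>c z)"
      using T zc by simp
    also have "(T *\<^sub>v z) \<bullet>c z = s"
      using proj[OF Sw] by (simp add: Tz' s_def)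
    finally show ?thesis .
  qed
  have w0: "w \<noteq> 0\<^sub>v n" using w1 by auto
  have pos: "0 < Re (mu * s)" using herm(2)[OF wc w0] by (simp add: Mww)
  then have mu: "mu \<noteq> 0" by auto
  have t: "0 < cmod (eig_min T)" "cmod (eig_min T) \<le> vec_norm2 (T *\<^sub>v z)"
    using hermitian_min_eigenvalue_norm_le[OF T Th _ zc z0] inv z1 by (auto simp: T_def)
  have HH: "mat_adjoint H * H = M * M"
  proof -
    have "M * M = mat_adjoint H * S * (S * H)"
      using herm(1) mat_adjoint_mult[OF S(1) H] S(2) by (simp add: M_def)
    also have "\<dots> = mat_adjoint H * (S * S * H)"
      using S(1) H by (simp add: assoc_mult_mat[of _ n n _ n _ n])
    also have "\<dots> = mat_adjoint H * H" using S(3) H by simp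
    finally show ?thesis by simp
  qed
  \<comment> \<open>The indefinite form is bounded below at the Ritz vector. The factor $|\tilde\lambda|$ turns
    $Tz$ into $Q^*Mw$ and $w^*Sw$ into $w^*Mw$, where the definiteness of $M$ can be used.\<close>
  have "cmod mu * cmod (eig_min T) \<le> cmod mu * vec_norm2 (T *\<^sub>v z)"
    using t by (intro mult_left_mono) auto
  also have "\<dots> = vec_norm2 (mat_adjoint Q *\<^sub>v (M *\<^sub>v w))"
    by (simp add: Tz vec_norm2_smult)
  also have "\<dots> \<le> vec_norm2 (M *\<^sub>v w)"
    by (rule vec_norm2_adjoint_isometry_le[OF Q Mw])
  also have "\<dots> \<le> sqrt (cond2 H) * Re (mu * s)"
    using pos_def_norm_le_sqrt_cond2[OF pdM M HH wc w1] by (simp only: Mww)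
  finally have low: "cmod mu * cmod (eig_min T) \<le> sqrt (cond2 H) * Re (mu * s)" .
  have "0 < cmod mu * cmod (eig_min T)" using mu t(1) by simp
  also note low
  finally have c0: "0 \<le> sqrt (cond2 H)"
    using pos by (simp only: zero_less_mult_iff) linarith
  have "sqrt (cond2 H) * Re (mu * s) \<le> sqrt (cond2 H) * (cmod mu * cmod s)"
    using c0 complex_Re_le_cmod[of "mu * s"] by (intro mult_left_mono) (auto simp: norm_mult)
  with low have "cmod mu * cmod (eig_min T) \<le> cmod mu * (sqrt (cond2 H) * cmod s)"
    by (simp add: mult_ac)
  then have ts: "cmod (eig_min T) \<le> sqrt (cond2 H) * cmod s"
    using mu by simp

  \<comment> \<open>The residual form $K$ is evaluated at $w$ in two ways.\<close>
  have vc: "v \<in> carrier_vec n" and v0: "v \<noteq> 0\<^sub>v n" and Hv: "H *\<^sub>v v = lam \<cdot>\<^sub>v v"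
    using v H by (auto simp: eigenvector_def)
  have Mv: "M *\<^sub>v v = lam \<cdot>\<^sub>v (S *\<^sub>v v)"
    using S H vc by (simp add: M_def Hv mult_mat_vec assoc_mult_mat_vec[of _ n n _ n])
  have "lam \<in> \<real>"
    by (rule definite_pencil_eigenvalue_real[OF pdM M S(1,2) vc v0 Mv])
  then have lam: "cnj lam = lam" by (simp add: Reals_cnj_iff)
  have KM: "K = M - lam \<cdot>\<^sub>m S"
    using S H by (simp add: K_def L_def M_def mult_minus_distrib_mat[of _ n n _ n]
        mult_smult_distrib[of _ n n _ n])
  have Kx: "K *\<^sub>v x = M *\<^sub>v x - lam \<cdot>\<^sub>v (S *\<^sub>v x)" if "x \<in> carrier_vec n" for x
    using M S that by (simp add: KM minus_mult_distrib_mat_vec[of _ n n] smult_mat_mult_vec[of _ n n])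
  have Kh: "mat_adjoint K = K"
    using M S by (simp add: KM mat_adjoint_minus[of _ n n] mat_adjoint_smult herm(1) lam)
  have Kv: "K *\<^sub>v v = 0\<^sub>v n"
    using S vc by (simp add: Kx[OF vc] Mv)
  have "(mu - lam) * s = (K *\<^sub>v w) \<bullet>c w"
    using M S wc Mw Sw
    by (simp add: Kx[OF wc] minus_scalar_prod_distrib[of _ n] Mww algebra_simps flip: s_def)
  also have "\<dots> = complex_of_real ((cmod \<sigma>)\<^sup>2) * ((K *\<^sub>v e) \<bullet>c e)"
    by (rule quadratic_form_kernel_perturbation[OF K Kh vc Kv e(1) w])
  finally have ms: "cmod (lam - mu) * cmod s = (cmod \<sigma>)\<^sup>2 * cmod ((K *\<^sub>v e) \<bullet>c e)"
    by (metis abs_of_nonneg norm_minus_commute norm_mult norm_of_real zero_le_power2)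
  have Le: "L *\<^sub>v e \<in> carrier_vec n" using L e by auto
  have "(K *\<^sub>v e) \<bullet>c e = (L *\<^sub>v e) \<bullet>c (S *\<^sub>v e)"
    using cscalar_prod_adjoint[OF S(1) Le e(1)] S L e by (simp add: K_def assoc_mult_mat_vec[of _ n n _ n])
  also have "cmod \<dots> \<le> vec_norm2 (L *\<^sub>v e) * vec_norm2 (S *\<^sub>v e)"
    using Le S e by (intro Cauchy_Schwarz_vec) auto
  also have "vec_norm2 (S *\<^sub>v e) = 1"
    using vec_norm2_isometry[OF S(1) _ e(1)] S e by simp
  also have "vec_norm2 (L *\<^sub>v e) * 1 \<le> op_norm2 L"
    using vec_norm2_mult_le_op_norm2[of e L] L e by simp
  finally have Ke: "cmod ((K *\<^sub>v e) \<bullet>c e) \<le> op_norm2 L" .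

  have "cmod (lam - mu) * cmod (eig_min T) \<le> cmod (lam - mu) * (sqrt (cond2 H) * cmod s)"
    using ts by (intro mult_left_mono) auto
  also have "\<dots> = sqrt (cond2 H) * ((cmod \<sigma>)\<^sup>2 * cmod ((K *\<^sub>v e) \<bullet>c e))"
    unfolding ms[symmetric] by (simp add: mult_ac)
  also have "\<dots> \<le> sqrt (cond2 H) * ((cmod \<sigma>)\<^sup>2 * op_norm2 L)"
    using c0 Ke by (intro mult_left_mono) auto
  finally show ?thesis
    using t(1) H by (simp add: kappa_def field_simps flip: T_def L_def)
qed

theorem lemma5p7:
  shows "\<exists>C::real. C > 0 \<and>
    (\<forall>(m::nat) (k::nat) (A::complex mat) (B::complex mat) (H::complex mat) (S::complex mat)
       (Q::complex mat) (lam::complex) (v::complex vec) (mu::complex) (w::complex vec)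
       (\<gamma>::complex) (\<sigma>::complex) (e::complex vec).
      m \<ge> 1 \<longrightarrow>
      A \<in> carrier_mat m m \<longrightarrow> B \<in> carrier_mat m m \<longrightarrow>
      mat_adjoint A = A \<longrightarrow> transpose_mat B = B \<longrightarrow>
      H = H_mat A B \<longrightarrow> S = S_mat m \<longrightarrow>
      hermitian_pos_def (S * H) \<longrightarrow>
      Q \<in> carrier_mat (2 * m) k \<longrightarrow> mat_adjoint Q * Q = 1\<^sub>m k \<longrightarrow>
      invertible_mat (mat_adjoint Q * S * Q) \<longrightarrow>
      ritz_pair H S Q mu w \<longrightarrow>
      eigenvector H v lam \<longrightarrow> vec_norm2 v = 1 \<longrightarrow>
      e \<in> carrier_vec (2 * m) \<longrightarrow> vec_norm2 e = 1 \<longrightarrow> e \<bullet>c v = 0 \<longrightarrow>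
      w = \<gamma> \<cdot>\<^sub>v v + \<sigma> \<cdot>\<^sub>v e \<longrightarrow>
      cmod (lam - mu) \<le> kappa H S Q lam * (C * (cmod \<sigma>)\<^sup>2))"
proof (intro exI[of _ 1] conjI allI impI)
  fix m k A B H S Q lam v mu w \<gamma> \<sigma> e
  assume "A \<in> carrier_mat m m" "B \<in> carrier_mat m m" and HS: "H = H_mat A B" "S = S_mat m"
    and rest: "hermitian_pos_def (S * H)" "Q \<in> carrier_mat (2 * m) k" "mat_adjoint Q * Q = 1\<^sub>m k"
      "invertible_mat (mat_adjoint Q * S * Q)" "ritz_pair H S Q mu w" "eigenvector H v lam"
      "e \<in> carrier_vec (2 * m)" "vec_norm2 e = 1" "w = \<gamma> \<cdot>\<^sub>v v + \<sigma> \<cdot>\<^sub>v e"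
  then have "H \<in> carrier_mat (2 * m) (2 * m)"
    by (simp add: H_mat_carrier)
  note H = this
  have S: "S \<in> carrier_mat (2 * m) (2 * m)" "mat_adjoint S = S" "S * S = 1\<^sub>m (2 * m)"
    unfolding HS by (rule S_mat_carrier S_mat_adjoint S_mat_square)+
  show "cmod (lam - mu) \<le> kappa H S Q lam * (1 * (cmod \<sigma>)\<^sup>2)"
    using ritz_value_quadratic_bound[OF S H rest] by simp
qed simp

end
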